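(* Let $b_0,q_0,k_b,k_q,k_2,k_3,\rho,\alpha,A_1,A_2,B,C,D$ be positive real numbers, let $\gamma=0$, and let $D=q_0\,\frac{C(1-\alpha)}{\alpha}$ (so that $0<\alpha<1$). Consider the diffusion-free BS-DIB system $$\dot b=f_1(b),\qquad \dot q=f_2(q),\qquad \dot\eta=f_3(b,\eta,\theta),\qquad \dot\theta=f_4(q,\eta,\theta)$$ in the unknowns $(b,q,\eta,\theta)\in\mathbb{R}^4$, where, for $\gamma=0$, $$f_1(b)=-k_b(b-b_0),\qquad f_2(q)=-k_q(q-q_0),$$ $$f_3(b,\eta,\theta)=\rho\left[A_1 b(1-\theta)\eta-A_2\eta^3-B(\theta-\alpha)\right],$$ $$f_4(q,\eta,\theta)=\rho\left[C q(1+k_2\eta)(1-\theta)-D(1+k_3\eta)\theta\right].$$ Then the equilibrium $(b^*,q^*,\eta^*,\theta^* )=(b_0,q_0,0,\alpha)$ is stable in the absence of diffusion if and only if $$B>\frac{A_1 b_0}{\alpha(k_2-k_3)}\qquad\text{and}\qquad C>\frac{b_0}{q_0}A_1\alpha(1-\alpha).$$ In addition, if $A_1=10$, $k_2=2.5$, $k_3=1.5$ and $\alpha=0.5$, this condition specializes to $$B>20\,b_0\qquad\text{and}\qquad C>2.5\,\frac{b_0}{q_0}.$$ Furthermore, if also $b_0=q_0=1$, it further reduces to $B>20$ and $C>2.5$.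
   Context: "Stable in the absence of diffusion" refers to the system linearized at the equilibrium: writing $\xi=(b,q,\eta,\theta)^T$, $\xi^*=(b^*,q^*,\eta^*,\theta^* )^T$ and letting $J(\xi^* )\in\mathbb{R}^{4\times 4}$ be the Jacobian matrix of the kinetics $(f_1,f_2,f_3,f_4)$ with respect to $(b,q,\eta,\theta)$ evaluated at $\xi^*$, the linearized diffusion-free system is $\dot\xi=J(\xi^* )(\xi-\xi^* )$. The equilibrium is called stable in the absence of diffusion if all (complex) eigenvalues of $J(\xi^* )$ have strictly negative real part. Background: the BS-DIB model is a bulk-surface reaction-diffusion system in which $b,q$ are bulk concentrations and $\eta,\theta$ are surface variables; the system considered here is obtained by dropping all diffusion terms from it.
   Formalization: The stability equivalence is stated only for k_2 > k_3: for k_2 = k_3 the bound on B is undefined, and for k_2 < k_3 the printed claim is false, since the bound on B always holds but the equilibrium is unstable. *)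

theory Defs
  imports "HOL-Analysis.Analysis"
begin

definition eigenvalue :: "'a::field ^ 'n ^ 'n \<Rightarrow> 'a \<Rightarrow> bool" where
  "eigenvalue A l \<longleftrightarrow> (\<exists>v. v \<noteq> 0 \<and> A *v v = l *s v)"

definition equilibrium :: "(real ^ 'n \<Rightarrow> real ^ 'n) \<Rightarrow> real ^ 'n \<Rightarrow> bool" where
  "equilibrium F x \<longleftrightarrow> F x = 0"

(* The library's jacobian is the matrix of the Frechet derivative, so this notion is
   meaningful only where F is differentiable; the kinetics below are polynomial. *)
definition linearly_stable :: "(real ^ 'n \<Rightarrow> real ^ 'n) \<Rightarrow> real ^ 'n \<Rightarrow> bool" where
  "linearly_stable F x \<longleftrightarrow>
     (\<forall>l. eigenvalue (map_matrix complex_of_real (jacobian F (at x))) l \<longrightarrow> Re l < 0)"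

definition f1 :: "real \<Rightarrow> real \<Rightarrow> real \<Rightarrow> real" where
  "f1 kb b0 b = - kb * (b - b0)"

definition f2 :: "real \<Rightarrow> real \<Rightarrow> real \<Rightarrow> real" where
  "f2 kq q0 q = - kq * (q - q0)"

(* f3 and f4 are the surface kinetics of the BS-DIB model with gamma = 0. *)
definition f3 ::
    "real \<Rightarrow> real \<Rightarrow> real \<Rightarrow> real \<Rightarrow> real \<Rightarrow> real \<Rightarrow> real \<Rightarrow> real \<Rightarrow> real" where
  "f3 \<rho> \<alpha> A1 A2 B b \<eta> \<theta> =
     \<rho> * (A1 * b * (1 - \<theta>) * \<eta> - A2 * \<eta> ^ 3 - B * (\<theta> - \<alpha>))"

definition f4 ::
    "real \<Rightarrow> real \<Rightarrow> real \<Rightarrow> real \<Rightarrow> real \<Rightarrow> real \<Rightarrow> real \<Rightarrow> real \<Rightarrow> real" where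
  "f4 \<rho> k2 k3 C D q \<eta> \<theta> =
     \<rho> * (C * q * (1 + k2 * \<eta>) * (1 - \<theta>) - D * (1 + k3 * \<eta>) * \<theta>)"

(* The components of the state are (b, q, eta, theta), in this order. *)
definition kinetics ::
    "real \<Rightarrow> real \<Rightarrow> real \<Rightarrow> real \<Rightarrow> real \<Rightarrow> real \<Rightarrow> real \<Rightarrow> real \<Rightarrow> real \<Rightarrow> real \<Rightarrow> real \<Rightarrow> real \<Rightarrow> real
      \<Rightarrow> real ^ 4 \<Rightarrow> real ^ 4" where
  "kinetics b0 q0 kb kq k2 k3 \<rho> \<alpha> A1 A2 B C D \<xi> =
     vector [f1 kb b0 (\<xi> $ 1),
             f2 kq q0 (\<xi> $ 2),
             f3 \<rho> \<alpha> A1 A2 B (\<xi> $ 1) (\<xi> $ 3) (\<xi> $ 4),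
             f4 \<rho> k2 k3 C D (\<xi> $ 2) (\<xi> $ 3) (\<xi> $ 4)]"

lemma vector_4:
  "(vector [w, x, y, z] :: 'a::zero ^ 4) $ 1 = w"
  "(vector [w, x, y, z] :: 'a ^ 4) $ 2 = x"
  "(vector [w, x, y, z] :: 'a ^ 4) $ 3 = y"
  "(vector [w, x, y, z] :: 'a ^ 4) $ 4 = z"
  by (simp_all add: vector_def)

end

theory Submission
  imports Defs
begin

text \<open>
  At the equilibrium the Jacobian has the eigenvalues \<open>-kb\<close> and \<open>-kq\<close> together with those of the
  surface block in \<open>(\<eta>, \<theta>)\<close>, since \<open>f1\<close> and \<open>f2\<close> decouple and \<open>\<partial>f3/\<partial>b\<close> vanishes where \<open>\<eta> = 0\<close>.
  Stability is therefore decided by the signs of the trace and determinant of the surface block,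
  and these give the bound on \<open>C\<close> and the bound on \<open>B\<close>, respectively.
\<close>

text \<open>This is the Routh-Hurwitz criterion in degree two: \<open>t\<close> is the sum and
  \<open>d\<close> the product of the roots, that is, the trace and determinant of a 2 by 2
  block.\<close>

lemma real_quadratic_roots_Re_neg_iff:
  fixes t d :: real
  shows "(\<forall>l::complex. l\<^sup>2 - of_real t * l + of_real d = 0 \<longrightarrow> Re l < 0) \<longleftrightarrow> t < 0 \<and> d > 0"
proof
  assume stable: "\<forall>l::complex. l\<^sup>2 - of_real t * l + of_real d = 0 \<longrightarrow> Re l < 0"
  have t: "t < 0"
  proof -
    \<comment> \<open>A complex square root of the discriminant gives both roots at once, whatever
      its sign. Their real parts add up to \<open>t\<close>.\<close>
    define s where "s = csqrt (of_real (t\<^sup>2 - 4 * d))"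
    have s2: "s\<^sup>2 = of_real t ^ 2 - 4 * of_real d"
      by (simp add: s_def)
    have "((of_real t + s) / 2)\<^sup>2 - of_real t * ((of_real t + s) / 2) + of_real d = 0"
      "((of_real t - s) / 2)\<^sup>2 - of_real t * ((of_real t - s) / 2) + of_real d = 0"
      using s2 by (simp_all add: field_simps) algebra+
    then have "Re ((of_real t + s) / 2) < 0" "Re ((of_real t - s) / 2) < 0"
      using stable by blast+
    then show ?thesis by simp
  qed
  have "d > 0"
  proof (rule ccontr)
    assume "\<not> d > 0"
    then have disc: "t\<^sup>2 \<le> t\<^sup>2 - 4 * d" by simp
    \<comment> \<open>For \<open>d\<close> at most 0 the discriminant is at least
      \<open>t\<^sup>2\<close>, so this larger root is real, and it is nonnegative because the
      square root dominates the absolute value of \<open>t\<close>.\<close>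
    define x where "x = (t + sqrt (t\<^sup>2 - 4 * d)) / 2"
    have "sqrt (t\<^sup>2 - 4 * d) ^ 2 = t\<^sup>2 - 4 * d"
      using disc order_trans[OF zero_le_power2 disc] by simp
    then have "x\<^sup>2 - t * x + d = 0"
      by (simp add: x_def power2_eq_square field_simps)
    then have "(of_real x :: complex)\<^sup>2 - of_real t * of_real x + of_real d = 0"
      by (metis of_real_0 of_real_add of_real_diff of_real_mult of_real_power)
    then have "x < 0"
      using stable by force
    moreover have "\<bar>t\<bar> \<le> sqrt (t\<^sup>2 - 4 * d)"
      using real_sqrt_le_mono[OF disc] by simp
    ultimately show False by (simp add: x_def)
  qed
  with t show "t < 0 \<and> d > 0" ..
next
  assume td: "t < 0 \<and> d > 0"
  show "\<forall>l::complex. l\<^sup>2 - of_real t * l + of_real d = 0 \<longrightarrow> Re l < 0"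
  proof (intro allI impI)
    fix l :: complex
    assume root: "l\<^sup>2 - of_real t * l + of_real d = 0"
    have re: "(Re l)\<^sup>2 - (Im l)\<^sup>2 - t * Re l + d = 0"
      using arg_cong[OF root, of Re] by (simp add: power2_eq_square)
    \<comment> \<open>The factorization shows that a nonreal root has real part
      \<open>t / 2\<close>. Only real roots then need the sign of \<open>d\<close>.\<close>
    have im: "Im l * (2 * Re l - t) = 0"
      using arg_cong[OF root, of Im] by (simp add: power2_eq_square algebra_simps)
    show "Re l < 0"
    proof (cases "Im l = 0")
      case True
      show ?thesis
      proof (rule ccontr)
        assume "\<not> Re l < 0"
        then have "t * Re l \<le> 0" using td by (simp add: mult_nonpos_nonneg)
        moreover have "(Re l)\<^sup>2 - t * Re l + d = 0" using re True by simp
        ultimately show False using td zero_le_power2[of "Re l"] by linarith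
      qed
    next
      case False
      then show ?thesis using im td by simp
    qed
  qed
qed

text \<open>The entries are free parameters, so that the spectral argument is separate from the
  kinetics. The surface block is \<open>a\<close>, \<open>b\<close>, \<open>c\<close>,
  \<open>d\<close>; here \<open>b\<close> is not the bulk concentration. The only coupling from bulk
  to surface is \<open>r\<close>.\<close>

definition kinetics_matrix ::
    "real \<Rightarrow> real \<Rightarrow> real \<Rightarrow> real \<Rightarrow> real \<Rightarrow> real \<Rightarrow> real \<Rightarrow> real ^ 4 ^ 4" where
  "kinetics_matrix kb kq r a b c d =
     vector [vector [- kb, 0, 0, 0],
             vector [0, - kq, 0, 0],
             vector [0, 0, a, b],
             vector [0, r, c, d]]"

text \<open>A nonzero bulk component of an eigenvector fixes \<open>l\<close> as one of the bulk
  rates. Otherwise the surface components form an eigenvector of the block.\<close>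

lemma eigenvalue_kinetics_matrix_cases:
  assumes "eigenvalue (map_matrix complex_of_real (kinetics_matrix kb kq r a b c d)) l"
  shows "l = of_real (- kb) \<or> l = of_real (- kq) \<or>
    l\<^sup>2 - of_real (a + d) * l + of_real (a * d - b * c) = 0"
proof -
  obtain v where v: "v \<noteq> 0"
    and Av: "map_matrix complex_of_real (kinetics_matrix kb kq r a b c d) *v v = l *s v"
    using assms by (auto simp: eigenvalue_def)
  have 1: "- of_real kb * v $ 1 = l * v $ 1"
    and 2: "- of_real kq * v $ 2 = l * v $ 2"
    and 3: "of_real a * v $ 3 + of_real b * v $ 4 = l * v $ 3"
    and 4: "of_real r * v $ 2 + of_real c * v $ 3 + of_real d * v $ 4 = l * v $ 4"
    using Av by (simp_all add: vec_eq_iff forall_4 matrix_vector_mult_def sum_4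
      map_matrix_def kinetics_matrix_def vector_4)
  show ?thesis
  proof (cases "v $ 1 = 0 \<and> v $ 2 = 0")
    case False
    then show ?thesis using 1 2 mult_right_cancel by (metis of_real_minus)
  next
    case True
    \<comment> \<open>Eliminating one surface component between equations 3 and 4 leaves the other
      multiplied by the characteristic polynomial of the block.\<close>
    define p where "p = l\<^sup>2 - of_real (a + d) * l + of_real (a * d - b * c)"
    have "p * v $ 3 = 0" "p * v $ 4 = 0"
      unfolding p_def of_real_add of_real_diff of_real_mult using 3 4 True by algebra+
    moreover have "v $ 3 \<noteq> 0 \<or> v $ 4 \<noteq> 0"
      using v True by (auto simp: vec_eq_iff forall_4)
    ultimately show ?thesis by (auto simp: p_def)
  qed
qed

text \<open>A converse is needed only for the surface roots, since the two bulk eigenvalues are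
  negative in any case.\<close>

lemma eigenvalue_kinetics_matrix_surface:
  assumes "b \<noteq> 0" and root: "l\<^sup>2 - of_real (a + d) * l + of_real (a * d - b * c) = 0"
  shows "eigenvalue (map_matrix complex_of_real (kinetics_matrix kb kq r a b c d)) l"
proof -
  \<comment> \<open>The vector is chosen to satisfy the first surface row identically; the second
    row then becomes the characteristic equation. The zero bulk components remove
    \<open>r\<close>.\<close>
  define v :: "complex ^ 4" where "v = vector [0, 0, - of_real b, of_real a - l]"
  have "v $ 3 \<noteq> 0"
    using assms by (simp add: v_def vector_4)
  then have "v \<noteq> 0" by auto
  moreover have "of_real d * (of_real a - l) - of_real c * of_real b = l * (of_real a - l)"
    using root unfolding of_real_add of_real_diff of_real_mult by algebra
  then have "map_matrix complex_of_real (kinetics_matrix kb kq r a b c d) *v v = l *s v"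
    by (simp add: vec_eq_iff forall_4 matrix_vector_mult_def sum_4
      map_matrix_def kinetics_matrix_def vector_4 v_def algebra_simps)
  ultimately show ?thesis by (auto simp: eigenvalue_def)
qed

lemma kinetics_matrix_stable_iff:
  assumes "kb > 0" "kq > 0" "b \<noteq> 0"
  shows "(\<forall>l. eigenvalue (map_matrix complex_of_real (kinetics_matrix kb kq r a b c d)) l \<longrightarrow> Re l < 0)
    \<longleftrightarrow> a + d < 0 \<and> a * d - b * c > 0"
  unfolding real_quadratic_roots_Re_neg_iff[symmetric]
proof (intro iffI allI impI)
  fix l :: complex
  assume "\<forall>l. eigenvalue (map_matrix complex_of_real (kinetics_matrix kb kq r a b c d)) l \<longrightarrow> Re l < 0"
    and "l\<^sup>2 - of_real (a + d) * l + of_real (a * d - b * c) = 0"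
  then show "Re l < 0"
    using eigenvalue_kinetics_matrix_surface[OF \<open>b \<noteq> 0\<close>] by blast
next
  fix l :: complex
  assume "\<forall>l::complex. l\<^sup>2 - of_real (a + d) * l + of_real (a * d - b * c) = 0 \<longrightarrow> Re l < 0"
    and "eigenvalue (map_matrix complex_of_real (kinetics_matrix kb kq r a b c d)) l"
  then show "Re l < 0"
    using eigenvalue_kinetics_matrix_cases[of kb kq r a b c d l] assms by fastforce
qed

lemma has_derivative_vec_nth_iff:
  fixes F :: "'a::real_normed_vector \<Rightarrow> real ^ 'n"
  shows "(F has_derivative F') (at x within S) \<longleftrightarrow>
    (\<forall>i. ((\<lambda>y. F y $ i) has_derivative (\<lambda>h. F' h $ i)) (at x within S))"
  by (subst has_derivative_componentwise_within) (auto simp: Basis_vec_def inner_axis)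

lemma jacobian_eqI:
  fixes M :: "real ^ 'n ^ 'm"
  assumes "(F has_derivative (\<lambda>h. M *v h)) (at x)"
  shows "jacobian F (at x) = M"
  unfolding jacobian_def frechet_derivative_at[OF assms, symmetric] by (rule matrix_of_matrix_vector_mul)

lemma jacobian_kinetics:
  "jacobian (kinetics b0 q0 kb kq k2 k3 \<rho> \<alpha> A1 A2 B C D) (at (vector [b0, q0, 0, \<alpha>])) =
    kinetics_matrix kb kq (\<rho> * C * (1 - \<alpha>)) (\<rho> * A1 * b0 * (1 - \<alpha>)) (- \<rho> * B)
      (\<rho> * (C * q0 * k2 * (1 - \<alpha>) - D * k3 * \<alpha>)) (- \<rho> * (C * q0 + D))"
  unfolding kinetics_def f1_def f2_def f3_def f4_def
  by (rule jacobian_eqI, unfold has_derivative_vec_nth_iff forall_4 vector_4, intro conjI)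
    (auto intro!: derivative_eq_intros bounded_linear_imp_has_derivative[OF bounded_linear_vec_nth]
      simp: kinetics_matrix_def matrix_vector_mult_def sum_4 vector_4 algebra_simps)

theorem theorem1:
  fixes b0 q0 kb kq k2 k3 \<rho> \<alpha> A1 A2 B C D :: real
  assumes "b0 > 0" "q0 > 0" "kb > 0" "kq > 0" "k2 > 0" "k3 > 0" "\<rho> > 0" "\<alpha> > 0"
    and "A1 > 0" "A2 > 0" "B > 0" "C > 0" "D > 0"
    and "D = q0 * (C * (1 - \<alpha>) / \<alpha>)"
  shows "\<alpha> < 1
    \<and> equilibrium (kinetics b0 q0 kb kq k2 k3 \<rho> \<alpha> A1 A2 B C D) (vector [b0, q0, 0, \<alpha>])
    \<and> (k2 > k3 \<longrightarrow>
        (linearly_stable (kinetics b0 q0 kb kq k2 k3 \<rho> \<alpha> A1 A2 B C D) (vector [b0, q0, 0, \<alpha>])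
          \<longleftrightarrow> B > A1 * b0 / (\<alpha> * (k2 - k3)) \<and> C > b0 / q0 * A1 * \<alpha> * (1 - \<alpha>)))
    \<and> (A1 = 10 \<and> k2 = 2.5 \<and> k3 = 1.5 \<and> \<alpha> = 0.5 \<longrightarrow>
        ((B > A1 * b0 / (\<alpha> * (k2 - k3)) \<and> C > b0 / q0 * A1 * \<alpha> * (1 - \<alpha>))
          \<longleftrightarrow> B > 20 * b0 \<and> C > 2.5 * (b0 / q0))
        \<and> (b0 = 1 \<and> q0 = 1 \<longrightarrow>
            (B > 20 * b0 \<and> C > 2.5 * (b0 / q0) \<longleftrightarrow> B > 20 \<and> C > 2.5)))"
proof -
  \<comment> \<open>With the division cleared, this relation is what makes \<open>f4\<close> vanish
    at the equilibrium, and positivity of both sides forces \<alpha> below 1.\<close>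
  have D: "D * \<alpha> = C * q0 * (1 - \<alpha>)"
    using assms by simp
  moreover have "D * \<alpha> > 0" "C * q0 > 0"
    using \<open>D > 0\<close> \<open>\<alpha> > 0\<close> \<open>C > 0\<close> \<open>q0 > 0\<close> by simp_all
  ultimately have \<alpha>1: "\<alpha> < 1"
    using zero_less_mult_pos[of "C * q0" "1 - \<alpha>"] by simp
  have equil: "equilibrium (kinetics b0 q0 kb kq k2 k3 \<rho> \<alpha> A1 A2 B C D) (vector [b0, q0, 0, \<alpha>])"
    using D by (simp add: equilibrium_def kinetics_def f1_def f2_def f3_def f4_def
      vec_eq_iff forall_4 vector_4)
  \<comment> \<open>The restriction to \<open>k2 > k3\<close> matters: for \<open>k2\<close> at most
    \<open>k3\<close> the determinant is negative, yet the stated bound on \<open>B\<close> is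
    nonpositive (division by zero gives 0) and holds for every positive \<open>B\<close>.\<close>
  have stable: "linearly_stable (kinetics b0 q0 kb kq k2 k3 \<rho> \<alpha> A1 A2 B C D) (vector [b0, q0, 0, \<alpha>])
      \<longleftrightarrow> B > A1 * b0 / (\<alpha> * (k2 - k3)) \<and> C > b0 / q0 * A1 * \<alpha> * (1 - \<alpha>)" if "k2 > k3"
  proof -
    let ?a = "\<rho> * A1 * b0 * (1 - \<alpha>)" and ?b = "- \<rho> * B"
      and ?c = "\<rho> * (C * q0 * k2 * (1 - \<alpha>) - D * k3 * \<alpha>)" and ?d = "- \<rho> * (C * q0 + D)"
    \<comment> \<open>Multiplying by \<alpha> eliminates \<open>D\<close>. Trace and determinant are
      therefore studied after multiplication by \<alpha>, which is positive and keeps their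
      signs.\<close>
    have d: "?d * \<alpha> = - \<rho> * C * q0"
      using D by algebra
    \<comment> \<open>Replacing \<open>D * \<alpha>\<close> gives both terms the common factor
      \<open>C * q0 * (1 - \<alpha>)\<close>, which is where the difference \<open>k2 - k3\<close>
      comes from.\<close>
    have c: "?c = \<rho> * C * q0 * (1 - \<alpha>) * (k2 - k3)"
      using D by algebra
    have "(?a + ?d) * \<alpha> = (\<rho> * q0) * (b0 / q0 * A1 * \<alpha> * (1 - \<alpha>) - C)"
      unfolding distrib_right d using assms by (simp add: field_simps)
    then have trace: "?a + ?d < 0 \<longleftrightarrow> C > b0 / q0 * A1 * \<alpha> * (1 - \<alpha>)"
      using assms by (smt (verit) mult_pos_pos mult_less_0_iff zero_less_mult_iff)
    have "(?a * ?d - ?b * ?c) * \<alpha> = ?a * (?d * \<alpha>) - ?b * ?c * \<alpha>"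
      by algebra
    also have "\<dots> = (\<rho>\<^sup>2 * C * q0 * (1 - \<alpha>)) * (B * (\<alpha> * (k2 - k3)) - A1 * b0)"
      unfolding d c by algebra
    finally have "(?a * ?d - ?b * ?c) * \<alpha> = \<dots>" .
    moreover have "\<rho>\<^sup>2 * C * q0 * (1 - \<alpha>) > 0"
      using assms \<alpha>1 by simp
    ultimately have "?a * ?d - ?b * ?c > 0 \<longleftrightarrow> B * (\<alpha> * (k2 - k3)) - A1 * b0 > 0"
      using \<open>\<alpha> > 0\<close> by (metis zero_less_mult_pos zero_less_mult_pos2 mult_pos_pos)
    also have "\<dots> \<longleftrightarrow> B > A1 * b0 / (\<alpha> * (k2 - k3))"
      using assms that by (simp add: pos_divide_less_eq)
    finally have det: "?a * ?d - ?b * ?c > 0 \<longleftrightarrow> B > A1 * b0 / (\<alpha> * (k2 - k3))" .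
    have "?b \<noteq> 0" using assms by simp
    then show ?thesis
      unfolding linearly_stable_def jacobian_kinetics
      using kinetics_matrix_stable_iff[OF \<open>kb > 0\<close> \<open>kq > 0\<close>] trace det by blast
  qed
  show ?thesis
  proof (intro conjI impI)
    assume "A1 = 10 \<and> k2 = 2.5 \<and> k3 = 1.5 \<and> \<alpha> = 0.5"
    then have "A1 = 10" "k2 = 5 / 2" "k3 = 3 / 2" "\<alpha> = 1 / 2" by simp_all
    then show "(B > A1 * b0 / (\<alpha> * (k2 - k3)) \<and> C > b0 / q0 * A1 * \<alpha> * (1 - \<alpha>))
        \<longleftrightarrow> B > 20 * b0 \<and> C > 2.5 * (b0 / q0)"
      by (simp only:) (simp add: mult.commute)
  qed (use \<alpha>1 equil stable in simp_all)
qed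

end
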